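(* Let $\mu>-1$, $q>-1$, $0\le\gamma<1$, and let $w:(0,\infty)\to(0,\infty)$ be a lower $q$-power weight, i.e. $w$ is positive, finite, measurable and $x\mapsto w(x)x^{-q}$ is nonincreasing on $(0,\infty)$. Then for all $x>0$, $$\int_0^x e^{-\gamma t}w(t)t^{-\mu}I_\mu(t)\,dt\ge L_{\mu,q}\,e^{-\gamma x}w(x)x^{-\mu}I_{\mu+1}(x),\qquad L_{\mu,q}=\min\left\{1,\frac{2(\mu+1)}{q+1}\right\}.$$ The constant $L_{\mu,q}$ is sharp when $\gamma=0$ and $w(x)=x^q$ (that is, in this case it cannot be replaced by any larger constant for which the inequality holds for all $x>0$).
   Context: $I_\alpha(x)=\sum_{k=0}^{\infty}\frac{(x/2)^{2k+\alpha}}{k!\,\Gamma(k+\alpha+1)}$, $x>0$, is the modified Bessel function of the first kind. The integral of the nonnegative integrand is understood as an element of $[0,\infty]$. *)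

theory Defs
  imports "HOL-Analysis.Analysis"
begin

text \<open>
  Modified Bessel function of the first kind, meant for \<open>x > 0\<close>. At the poles of \<^const>\<open>Gamma\<close>
  (which do not occur for \<open>\<alpha> > -1\<close>) both \<open>Gamma\<close> and division by zero evaluate to \<open>0\<close>, in
  agreement with the usual convention \<open>1 / \<Gamma>(-n) = 0\<close>.
\<close>
definition bessel_I :: "real \<Rightarrow> real \<Rightarrow> real" where
  "bessel_I \<alpha> x =
     (\<Sum>k. (x / 2) powr (2 * real k + \<alpha>) / (fact k * Gamma (real k + \<alpha> + 1)))"

text \<open>
  A weight is a function on \<open>(0, \<infinity>)\<close>: its values at \<open>x \<le> 0\<close> are irrelevant.
\<close>
definition lower_power_weight :: "real \<Rightarrow> (real \<Rightarrow> real) \<Rightarrow> bool" where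
  "lower_power_weight q w \<longleftrightarrow>
     (\<forall>x>0. w x > 0) \<and>
     w \<in> borel_measurable (lebesgue_on {0<..}) \<and>
     antimono_on {0<..} (\<lambda>x. w x * x powr (- q))"

definition L_const :: "real \<Rightarrow> real \<Rightarrow> real" where
  "L_const \<mu> q = min 1 (2 * (\<mu> + 1) / (q + 1))"

end

theory Submission
  imports Defs
begin

text \<open>
  Everything is read off from coefficients of power series in \<open>t\<^sup>2\<close>. With
  \<open>a\<^sub>k = 1 / (2\<^sup>\<mu> 4\<^sup>k k! \<Gamma>(k + \<mu> + 1)) > 0\<close> one has
  \<open>t\<^sup>-\<^sup>\<mu> I\<^sub>\<mu>(t) = \<Sum> a\<^sub>k t\<^sup>2\<^sup>k\<close>, and the functional equation of \<open>\<Gamma>\<close> gives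
  \<open>x\<^sup>-\<^sup>\<mu> I\<^sub>\<mu>\<^sub>+\<^sub>1(x) = x \<Sum> a\<^sub>k / (2 (k + \<mu> + 1)) x\<^sup>2\<^sup>k\<close>.

  For \<open>0 < t < x\<close> the exponential factor is at least \<open>exp (- \<gamma> x)\<close> and the weight is at least
  \<open>w(x) (t/x)\<^sup>q\<close>, so the inequality reduces to the pure power weight without exponential factor.
  There, integrating term by term produces \<open>x\<^sup>q\<^sup>+\<^sup>1 \<Sum> a\<^sub>k / (2k + q + 1) x\<^sup>2\<^sup>k\<close>, and the claim
  holds coefficientwise (\<open>L_const_coeff_le\<close>): \<open>L (2k + q + 1) \<le> 2 (k + \<mu> + 1)\<close> because \<open>L \<le> 1\<close>
  and \<open>L (q + 1) \<le> 2 (\<mu> + 1)\<close>.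

  The two entries of the minimum are exactly the quotients of the coefficients for \<open>k = 0\<close> and
  for \<open>k \<rightarrow> \<infinity>\<close>, and these govern the quotient of the two sides for \<open>x \<rightarrow> 0\<close> and \<open>x \<rightarrow> \<infinity>\<close>. Hence
  sharpness: if \<open>C\<close> is admissible, then the power series with coefficients
  \<open>C a\<^sub>k / (2 (k + \<mu> + 1)) - a\<^sub>k / (2k + q + 1)\<close> is nonpositive on \<open>(0, \<infinity>)\<close>. So its constant term
  is nonpositive (\<open>powser_nonpos_imp_coeff_0_nonpos\<close>), and its coefficients cannot be eventually
  positive (\<open>powser_nonpos_imp_not_eventually_pos\<close>), which they would be for \<open>C > 1\<close>.
\<close>

section \<open>The power series of the modified Bessel function\<close>

definition bessel_coeff :: "real \<Rightarrow> nat \<Rightarrow> real" where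
  "bessel_coeff \<mu> k = 1 / (2 powr \<mu> * 4 ^ k * fact k * Gamma (real k + \<mu> + 1))"

lemma bessel_coeff_pos:
  assumes "\<mu> > -1"
  shows "bessel_coeff \<mu> k > 0"
proof -
  have "Gamma (real k + \<mu> + 1) > 0"
    using assms by (intro Gamma_real_pos) auto
  then show ?thesis
    by (simp add: bessel_coeff_def)
qed

lemma Gamma_plus1_of_pos: "(s::real) > 0 \<Longrightarrow> Gamma (s + 1) = s * Gamma s"
  by (rule Gamma_plus1) (auto elim!: nonpos_Ints_cases)

lemma bessel_coeff_Suc:
  assumes "\<mu> > -1"
  shows "bessel_coeff \<mu> (Suc k) = bessel_coeff \<mu> k / (4 * (real k + 1) * (real k + \<mu> + 1))"
proof -
  have "Gamma (real (Suc k) + \<mu> + 1) = (real k + \<mu> + 1) * Gamma (real k + \<mu> + 1)"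
    using assms Gamma_plus1_of_pos[of "real k + \<mu> + 1"] by (simp add: add_ac)
  then show ?thesis
    by (simp add: bessel_coeff_def field_simps)
qed

lemma bessel_coeff_plus1:
  assumes "\<mu> > -1"
  shows "bessel_coeff (\<mu> + 1) k = bessel_coeff \<mu> k / (2 * (real k + \<mu> + 1))"
proof -
  have "Gamma (real k + (\<mu> + 1) + 1) = (real k + \<mu> + 1) * Gamma (real k + \<mu> + 1)"
    using assms Gamma_plus1_of_pos[of "real k + \<mu> + 1"] by (simp add: add_ac)
  moreover have "(2::real) powr (\<mu> + 1) = 2 * 2 powr \<mu>"
    by (simp add: powr_add)
  ultimately show ?thesis
    by (simp add: bessel_coeff_def field_simps)
qed

lemma summable_bessel_coeff:
  assumes "\<mu> > -1"
  shows "summable (\<lambda>k. bessel_coeff \<mu> k * y ^ k)"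
proof -
  obtain N :: nat where N: "real N > \<bar>y\<bar>"
    using reals_Archimedean2 by blast
  show ?thesis
  proof (rule summable_ratio_test[of "1/2" "Suc N"])
    fix k assume k: "k \<ge> Suc N"
    let ?D = "4 * (real k + 1) * (real k + \<mu> + 1)"
    have "2 * \<bar>y\<bar> \<le> 2 * real k * 1"
      using N k by linarith
    also have "\<dots> \<le> 4 * (real k + 1) * (real k + \<mu> + 1)"
      using assms k by (intro mult_mono) auto
    finally have D: "2 * \<bar>y\<bar> \<le> ?D" .
    have "?D > 0"
      using assms by simp
    with D have "\<bar>y\<bar> / ?D \<le> 1 / 2"
      by (simp add: divide_le_eq)
    then have "\<bar>bessel_coeff \<mu> k * y ^ k\<bar> * (\<bar>y\<bar> / ?D) \<le> \<bar>bessel_coeff \<mu> k * y ^ k\<bar> * (1 / 2)"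
      by (intro mult_left_mono) auto
    moreover have "norm (bessel_coeff \<mu> (Suc k) * y ^ Suc k)
        = \<bar>bessel_coeff \<mu> k * y ^ k\<bar> * (\<bar>y\<bar> / ?D)"
      using \<open>?D > 0\<close> assms by (simp add: bessel_coeff_Suc abs_mult)
    ultimately show "norm (bessel_coeff \<mu> (Suc k) * y ^ Suc k)
        \<le> 1 / 2 * norm (bessel_coeff \<mu> k * y ^ k)"
      by simp
  qed simp
qed

lemma bessel_I_powser:
  assumes "\<mu> > -1" and "t > 0"
  shows "(\<lambda>k. bessel_coeff \<mu> k * (t\<^sup>2) ^ k) sums (t powr (- \<mu>) * bessel_I \<mu> t)"
proof -
  have term_eq: "(t / 2) powr (2 * real k + \<mu>) / (fact k * Gamma (real k + \<mu> + 1))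
      = t powr \<mu> * (bessel_coeff \<mu> k * (t\<^sup>2) ^ k)" for k
  proof -
    have "(t / 2) powr (2 * real k + \<mu>) = (t / 2) powr real (2 * k) * (t / 2) powr \<mu>"
      by (simp add: powr_add)
    also have "(t / 2) powr real (2 * k) = (t\<^sup>2) ^ k / 4 ^ k"
      using \<open>t > 0\<close> by (subst powr_realpow) (auto simp: power_divide power_mult)
    also have "(t / 2) powr \<mu> = t powr \<mu> / 2 powr \<mu>"
      using \<open>t > 0\<close> by (simp add: powr_divide)
    finally show ?thesis
      by (simp add: bessel_coeff_def mult_ac)
  qed
  have "bessel_I \<mu> t = t powr \<mu> * (\<Sum>k. bessel_coeff \<mu> k * (t\<^sup>2) ^ k)"
    unfolding bessel_I_def term_eq
    by (rule suminf_mult[OF summable_bessel_coeff[OF assms(1)]])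
  then have "t powr (- \<mu>) * bessel_I \<mu> t = (\<Sum>k. bessel_coeff \<mu> k * (t\<^sup>2) ^ k)"
    using \<open>t > 0\<close> by (simp add: powr_minus)
  then show ?thesis
    using summable_sums[OF summable_bessel_coeff[OF assms(1)]] by simp
qed

lemma bessel_I_plus1_powser:
  assumes "\<mu> > -1" and "x > 0"
  shows "x powr (- \<mu>) * bessel_I (\<mu> + 1) x = x * (\<Sum>k. bessel_coeff (\<mu> + 1) k * (x\<^sup>2) ^ k)"
proof -
  have "x powr (- \<mu>) = x * x powr (- (\<mu> + 1))"
    using \<open>x > 0\<close> powr_add[of x 1 "- (\<mu> + 1)"] by simp
  moreover have "(\<Sum>k. bessel_coeff (\<mu> + 1) k * (x\<^sup>2) ^ k)
      = x powr (- (\<mu> + 1)) * bessel_I (\<mu> + 1) x"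
    using assms by (intro sums_unique[symmetric] bessel_I_powser) auto
  ultimately show ?thesis
    by (simp add: mult.assoc)
qed

section \<open>Termwise integration\<close>

lemma nn_integral_powr_Ioo:
  assumes "s > -1" and "x > (0::real)"
  shows "(\<integral>\<^sup>+t\<in>{0<..<x}. ennreal (t powr s) \<partial>lebesgue) = ennreal (x powr (s + 1) / (s + 1))"
proof -
  have "((\<lambda>t. t powr s) has_integral (x powr (s + 1) / (s + 1))) {0<..<x}"
    using has_integral_powr_from_0[of s x] assms by (simp add: has_integral_Icc_iff_Ioo)
  then have "(\<integral>\<^sup>+t. ennreal (indicator {0<..<x} t * t powr s) \<partial>lborel)
      = ennreal (x powr (s + 1) / (s + 1))"
    by (intro nn_integral_has_integral_lebesgue) auto
  moreover have "(\<integral>\<^sup>+t\<in>{0<..<x}. ennreal (t powr s) \<partial>lborel)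
      = (\<integral>\<^sup>+t. ennreal (indicator {0<..<x} t * t powr s) \<partial>lborel)"
    by (intro nn_integral_cong) (auto simp: indicator_def)
  ultimately show ?thesis
    by (simp add: nn_integral_completion)
qed

lemma summable_bessel_coeff_integrated:
  assumes "\<mu> > -1" and "q > -1"
  shows "summable (\<lambda>k. bessel_coeff \<mu> k / (2 * real k + q + 1) * y ^ k)"
proof (rule summable_comparison_test)
  have "summable (\<lambda>k. bessel_coeff \<mu> k * \<bar>y\<bar> ^ k)"
    by (rule summable_bessel_coeff[OF assms(1)])
  then show "summable (\<lambda>k. 1 / (q + 1) * (bessel_coeff \<mu> k * \<bar>y\<bar> ^ k))"
    by (rule summable_mult)
  show "\<exists>N. \<forall>k\<ge>N. norm (bessel_coeff \<mu> k / (2 * real k + q + 1) * y ^ k)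
      \<le> 1 / (q + 1) * (bessel_coeff \<mu> k * \<bar>y\<bar> ^ k)"
  proof (intro exI allI impI)
    fix k :: nat
    have "0 < q + 1" "q + 1 \<le> 2 * real k + q + 1"
      using assms(2) by auto
    then have "bessel_coeff \<mu> k * \<bar>y\<bar> ^ k / (2 * real k + q + 1)
        \<le> bessel_coeff \<mu> k * \<bar>y\<bar> ^ k / (q + 1)"
      using bessel_coeff_pos[OF assms(1), of k] by (intro divide_left_mono) auto
    then show "norm (bessel_coeff \<mu> k / (2 * real k + q + 1) * y ^ k)
        \<le> 1 / (q + 1) * (bessel_coeff \<mu> k * \<bar>y\<bar> ^ k)"
      using bessel_coeff_pos[OF assms(1), of k] \<open>0 < q + 1\<close>
      by (simp add: abs_mult power_abs)
  qed
qed

text \<open>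
  All terms of the series are nonnegative, so it may be integrated term by term; the condition
  \<open>q > -1\<close> is what makes each \<open>t\<^sup>2\<^sup>k\<^sup>+\<^sup>q\<close> integrable at \<open>0\<close>.
\<close>
lemma nn_integral_powr_bessel_I:
  assumes "\<mu> > -1" and "q > -1" and "x > 0"
  shows "(\<integral>\<^sup>+t\<in>{0<..<x}. ennreal (t powr q * t powr (- \<mu>) * bessel_I \<mu> t) \<partial>lebesgue)
    = ennreal (x powr (q + 1) * (\<Sum>k. bessel_coeff \<mu> k / (2 * real k + q + 1) * (x\<^sup>2) ^ k))"
proof -
  have pos: "bessel_coeff \<mu> k > 0" for k
    by (rule bessel_coeff_pos[OF assms(1)])
  have powr_shift: "t powr s * (t\<^sup>2) ^ k = t powr (2 * real k + s)" if "t > 0" for t s :: real and k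
  proof -
    have "(t\<^sup>2) ^ k = t powr real (2 * k)"
      using that by (subst powr_realpow) (auto simp: power_mult)
    then show ?thesis
      by (simp add: powr_add)
  qed
  have integrand: "ennreal (t powr q * t powr (- \<mu>) * bessel_I \<mu> t) * indicator {0<..<x} t
      = (\<Sum>k. ennreal (bessel_coeff \<mu> k) * (ennreal (t powr (2 * real k + q)) * indicator {0<..<x} t))"
    for t
  proof (cases "t \<in> {0<..<x}")
    case True
    then have "t > 0" by simp
    have "(\<lambda>k. t powr q * (bessel_coeff \<mu> k * (t\<^sup>2) ^ k))
        sums (t powr q * (t powr (- \<mu>) * bessel_I \<mu> t))"
      by (intro sums_mult bessel_I_powser assms \<open>t > 0\<close>)
    then have "(\<lambda>k. bessel_coeff \<mu> k * t powr (2 * real k + q))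
        sums (t powr q * t powr (- \<mu>) * bessel_I \<mu> t)"
      unfolding powr_shift[OF \<open>t > 0\<close>, symmetric] by (simp add: mult_ac)
    then have "(\<Sum>k. ennreal (bessel_coeff \<mu> k * t powr (2 * real k + q)))
        = ennreal (t powr q * t powr (- \<mu>) * bessel_I \<mu> t)"
      using pos by (intro suminf_ennreal_eq) (simp_all add: less_imp_le)
    then show ?thesis
      using True pos by (simp add: ennreal_mult' less_imp_le)
  qed simp
  have "(\<integral>\<^sup>+t\<in>{0<..<x}. ennreal (t powr q * t powr (- \<mu>) * bessel_I \<mu> t) \<partial>lebesgue)
      = (\<Sum>k. \<integral>\<^sup>+t. ennreal (bessel_coeff \<mu> k)
          * (ennreal (t powr (2 * real k + q)) * indicator {0<..<x} t) \<partial>lebesgue)"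
    unfolding integrand nn_integral_completion by (rule nn_integral_suminf) measurable
  also have "\<dots> = (\<Sum>k. ennreal (bessel_coeff \<mu> k)
      * (\<integral>\<^sup>+t\<in>{0<..<x}. ennreal (t powr (2 * real k + q)) \<partial>lebesgue))"
    by (simp add: nn_integral_completion nn_integral_cmult)
  also have "\<dots> = (\<Sum>k. ennreal (x powr (q + 1)
      * (bessel_coeff \<mu> k / (2 * real k + q + 1) * (x\<^sup>2) ^ k)))"
  proof (rule arg_cong[where f = suminf], rule ext)
    fix k
    have "(\<integral>\<^sup>+t\<in>{0<..<x}. ennreal (t powr (2 * real k + q)) \<partial>lebesgue)
        = ennreal (x powr (2 * real k + (q + 1)) / (2 * real k + q + 1))"
      using assms by (subst nn_integral_powr_Ioo) (auto simp: add_ac)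
    then show "ennreal (bessel_coeff \<mu> k)
        * (\<integral>\<^sup>+t\<in>{0<..<x}. ennreal (t powr (2 * real k + q)) \<partial>lebesgue)
      = ennreal (x powr (q + 1) * (bessel_coeff \<mu> k / (2 * real k + q + 1) * (x\<^sup>2) ^ k))"
      using pos[of k] powr_shift[OF assms(3), of "q + 1" k, symmetric]
      by (simp add: ennreal_mult'[symmetric] less_imp_le mult_ac)
  qed
  also have "\<dots> = ennreal (x powr (q + 1)
      * (\<Sum>k. bessel_coeff \<mu> k / (2 * real k + q + 1) * (x\<^sup>2) ^ k))"
    using pos assms
    by (intro suminf_ennreal_eq sums_mult summable_sums summable_bessel_coeff_integrated)
       (auto intro!: mult_nonneg_nonneg divide_nonneg_nonneg intro: less_imp_le)
  finally show ?thesis .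
qed

section \<open>The lower bound\<close>

text \<open>
  The quotient of the coefficients is \<open>2 (k + \<mu> + 1) / (2k + q + 1)\<close>, which moves monotonically
  from \<open>2 (\<mu> + 1) / (q + 1)\<close> at \<open>k = 0\<close> to \<open>1\<close> for \<open>k \<rightarrow> \<infinity>\<close>.
\<close>
lemma L_const_coeff_le:
  assumes "\<mu> > -1" and "q > -1"
  shows "L_const \<mu> q * bessel_coeff (\<mu> + 1) k \<le> bessel_coeff \<mu> k / (2 * real k + q + 1)"
proof -
  let ?L = "L_const \<mu> q"
  have "?L \<le> 2 * (\<mu> + 1) / (q + 1)"
    by (simp add: L_const_def)
  then have "?L * (q + 1) \<le> 2 * (\<mu> + 1)"
    using assms(2) by (simp add: le_divide_eq)
  moreover have "?L * (2 * real k) \<le> 1 * (2 * real k)"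
    by (intro mult_right_mono) (auto simp: L_const_def)
  ultimately have "?L * (2 * real k + q + 1) \<le> 2 * (real k + \<mu> + 1)"
    by (simp add: algebra_simps)
  then have "?L / (2 * (real k + \<mu> + 1)) \<le> 1 / (2 * real k + q + 1)"
    using assms by (simp add: field_simps)
  then have "bessel_coeff \<mu> k * (?L / (2 * (real k + \<mu> + 1)))
      \<le> bessel_coeff \<mu> k * (1 / (2 * real k + q + 1))"
    using bessel_coeff_pos[OF assms(1), of k] by (intro mult_left_mono) auto
  then show ?thesis
    by (simp add: bessel_coeff_plus1[OF assms(1)] mult.commute)
qed

lemma power_weight_integral_ge:
  assumes "\<mu> > -1" and "q > -1" and "x > 0"
  shows "(\<integral>\<^sup>+t\<in>{0<..<x}. ennreal (t powr q * t powr (- \<mu>) * bessel_I \<mu> t) \<partial>lebesgue)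
    \<ge> ennreal (x powr q * (L_const \<mu> q * (x powr (- \<mu>) * bessel_I (\<mu> + 1) x)))"
proof -
  have summ: "summable (\<lambda>k. bessel_coeff (\<mu> + 1) k * (x\<^sup>2) ^ k)"
    using assms by (intro summable_bessel_coeff) simp
  have "L_const \<mu> q * (\<Sum>k. bessel_coeff (\<mu> + 1) k * (x\<^sup>2) ^ k)
      = (\<Sum>k. L_const \<mu> q * bessel_coeff (\<mu> + 1) k * (x\<^sup>2) ^ k)"
    by (simp add: suminf_mult[OF summ, symmetric] mult.assoc)
  also have "\<dots> \<le> (\<Sum>k. bessel_coeff \<mu> k / (2 * real k + q + 1) * (x\<^sup>2) ^ k)"
  proof (rule suminf_le)
    show "L_const \<mu> q * bessel_coeff (\<mu> + 1) k * (x\<^sup>2) ^ k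
        \<le> bessel_coeff \<mu> k / (2 * real k + q + 1) * (x\<^sup>2) ^ k" for k
      using assms by (intro mult_right_mono L_const_coeff_le) auto
    show "summable (\<lambda>k. L_const \<mu> q * bessel_coeff (\<mu> + 1) k * (x\<^sup>2) ^ k)"
      using summable_mult[OF summ, of "L_const \<mu> q"] by (simp add: mult.assoc)
  qed (use assms summable_bessel_coeff_integrated in auto)
  finally have "x powr (q + 1) * (L_const \<mu> q * (\<Sum>k. bessel_coeff (\<mu> + 1) k * (x\<^sup>2) ^ k))
      \<le> x powr (q + 1) * (\<Sum>k. bessel_coeff \<mu> k / (2 * real k + q + 1) * (x\<^sup>2) ^ k)"
    by (intro mult_left_mono) auto
  moreover have "x powr (q + 1) = x powr q * x"
    using assms(3) by (simp add: powr_add)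
  ultimately show ?thesis
    unfolding nn_integral_powr_bessel_I[OF assms] bessel_I_plus1_powser[OF assms(1,3)]
    by (intro ennreal_leI) (simp add: mult_ac)
qed

lemma borel_measurable_bessel_I [measurable]: "bessel_I \<mu> \<in> borel_measurable borel"
  unfolding bessel_I_def[abs_def] by measurable

text \<open>
  On \<open>(0, x]\<close> the function \<open>exp (- \<gamma> t) w(t) t\<^sup>-\<^sup>q\<close> is nonincreasing, so it can be replaced by its
  value at \<open>x\<close>, the constant \<open>c\<close> below; the weight \<open>t\<^sup>q\<close> remains under the integral.
\<close>
lemma weighted_integral_ge:
  assumes "\<mu> > -1" and "q > -1" and "0 \<le> \<gamma>" and w: "lower_power_weight q w" and "x > 0"
  shows "(\<integral>\<^sup>+t\<in>{0<..<x}. ennreal (exp (- \<gamma> * t) * w t * t powr (- \<mu>) * bessel_I \<mu> t) \<partial>lebesgue)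
    \<ge> ennreal (L_const \<mu> q * exp (- \<gamma> * x) * w x * x powr (- \<mu>) * bessel_I (\<mu> + 1) x)"
proof -
  define c where "c = exp (- \<gamma> * x) * (w x * x powr (- q))"
  have w_pos: "w t > 0" if "t > 0" for t
    using w that by (simp add: lower_power_weight_def)
  have "c \<ge> 0"
    using w_pos[OF assms(5)] by (simp add: c_def)
  have pointwise: "c * (t powr q * t powr (- \<mu>) * bessel_I \<mu> t)
      \<le> exp (- \<gamma> * t) * w t * t powr (- \<mu>) * bessel_I \<mu> t" if t: "0 < t" "t < x" for t
  proof -
    have nonneg: "t powr (- \<mu>) * bessel_I \<mu> t \<ge> 0"
      using sums_le[OF _ sums_zero bessel_I_powser[OF assms(1) t(1)]] bessel_coeff_pos[OF assms(1)]
      by (simp add: less_imp_le)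
    have "antimono_on {0<..} (\<lambda>x. w x * x powr (- q))"
      using w by (simp add: lower_power_weight_def)
    then have "w x * x powr (- q) \<le> w t * t powr (- q)"
      using t by (auto simp: monotone_on_def)
    then have "c \<le> exp (- \<gamma> * t) * (w t * t powr (- q))"
      unfolding c_def using t assms(3) w_pos[of x]
      by (intro mult_mono[of "exp (- \<gamma> * x)"]) (auto intro: mult_left_mono)
    then have "c * t powr q \<le> exp (- \<gamma> * t) * (w t * t powr (- q)) * t powr q"
      by (intro mult_right_mono) auto
    also have "\<dots> = exp (- \<gamma> * t) * w t"
      using t(1) by (simp add: powr_minus)
    finally have "c * t powr q \<le> exp (- \<gamma> * t) * w t" .
    from mult_right_mono[OF this nonneg] show ?thesis
      by (simp add: mult.assoc)
  qed
  have "ennreal (L_const \<mu> q * exp (- \<gamma> * x) * w x * x powr (- \<mu>) * bessel_I (\<mu> + 1) x)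
      = ennreal c * ennreal (x powr q * (L_const \<mu> q * (x powr (- \<mu>) * bessel_I (\<mu> + 1) x)))"
    using \<open>c \<ge> 0\<close> assms(5)
    by (subst ennreal_mult'[symmetric]) (auto simp: c_def powr_minus field_simps)
  also have "\<dots> \<le> ennreal c
      * (\<integral>\<^sup>+t\<in>{0<..<x}. ennreal (t powr q * t powr (- \<mu>) * bessel_I \<mu> t) \<partial>lebesgue)"
    by (intro mult_left_mono power_weight_integral_ge assms) auto
  also have "\<dots> = (\<integral>\<^sup>+t. ennreal c
      * (ennreal (t powr q * t powr (- \<mu>) * bessel_I \<mu> t) * indicator {0<..<x} t) \<partial>lebesgue)"
    by (simp add: nn_integral_completion nn_integral_cmult)
  also have "\<dots> \<le> (\<integral>\<^sup>+t\<in>{0<..<x}.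
      ennreal (exp (- \<gamma> * t) * w t * t powr (- \<mu>) * bessel_I \<mu> t) \<partial>lebesgue)"
  proof (rule nn_integral_mono)
    fix t
    show "ennreal c * (ennreal (t powr q * t powr (- \<mu>) * bessel_I \<mu> t) * indicator {0<..<x} t)
      \<le> ennreal (exp (- \<gamma> * t) * w t * t powr (- \<mu>) * bessel_I \<mu> t) * indicator {0<..<x} t"
      using pointwise[of t] \<open>c \<ge> 0\<close>
      by (cases "t \<in> {0<..<x}") (auto simp: ennreal_mult'[symmetric] intro!: ennreal_leI)
  qed
  finally show ?thesis .
qed

section \<open>Sharpness for power weights\<close>

lemma powser_nonpos_imp_coeff_0_nonpos:
  fixes d :: "nat \<Rightarrow> real"
  assumes summ: "\<And>y. summable (\<lambda>k. d k * y ^ k)"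
    and le: "\<And>y. y > 0 \<Longrightarrow> (\<Sum>k. d k * y ^ k) \<le> 0"
  shows "d 0 \<le> 0"
proof -
  have "((\<lambda>y. \<Sum>k. d k * y ^ k) \<longlongrightarrow> d 0) (at 0)"
    using summ by (intro powser_limit_0[of 1]) (auto intro: summable_sums)
  then have "((\<lambda>y. \<Sum>k. d k * y ^ k) \<longlongrightarrow> d 0) (at_right 0)"
    by (rule filterlim_mono) (auto simp: at_within_le_at)
  then show ?thesis
    by (rule tendsto_upperbound) (auto simp: eventually_at_filter le)
qed

text \<open>
  Past some index \<open>N\<close> all terms are positive, so already the partial sum up to \<open>N\<close> is nonpositive
  on \<open>(0, \<infinity>)\<close>; but it is a polynomial with positive leading coefficient.
\<close>
lemma powser_nonpos_imp_not_eventually_pos: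
  fixes d :: "nat \<Rightarrow> real"
  assumes summ: "\<And>y. summable (\<lambda>k. d k * y ^ k)"
    and le: "\<And>y. y > 0 \<Longrightarrow> (\<Sum>k. d k * y ^ k) \<le> 0"
  shows "\<not> eventually (\<lambda>k. d k > 0) sequentially"
proof
  assume "eventually (\<lambda>k. d k > 0) sequentially"
  then obtain N where N: "\<And>k. k \<ge> N \<Longrightarrow> d k > 0"
    by (auto simp: eventually_sequentially)
  define S where "S = (\<Sum>k<N. \<bar>d k\<bar>)"
  have "S \<ge> 0"
    by (simp add: S_def sum_nonneg)
  have "d N > 0"
    using N by simp
  \<comment> \<open>At this point the leading term exceeds all lower ones together.\<close>
  define y where "y = 1 + S / d N"
  have "y \<ge> 1"
    using \<open>S \<ge> 0\<close> \<open>d N > 0\<close> by (simp add: y_def)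
  have "(\<Sum>k<Suc N. d k * y ^ k) \<le> (\<Sum>k. d k * y ^ k)"
    using N \<open>y \<ge> 1\<close> by (intro sum_le_suminf summ) (auto intro!: mult_nonneg_nonneg intro: less_imp_le)
  also have "\<dots> \<le> 0"
    using \<open>y \<ge> 1\<close> by (intro le) simp
  finally have "y * (d N * y ^ N) \<le> y * - (\<Sum>k<N. d k * y ^ k)"
    using \<open>y \<ge> 1\<close> by (intro mult_left_mono) auto
  also have "\<dots> = (\<Sum>k<N. - d k * y ^ Suc k)"
    by (simp add: sum_distrib_left sum_negf mult_ac)
  also have "\<dots> \<le> (\<Sum>k<N. \<bar>d k\<bar> * y ^ N)"
    using \<open>y \<ge> 1\<close> by (intro sum_mono mult_mono power_increasing) auto
  also have "\<dots> = S * y ^ N"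
    by (simp add: S_def sum_distrib_right)
  finally have "y * d N \<le> S"
    using \<open>y \<ge> 1\<close> by (simp add: mult.assoc[symmetric])
  moreover have "y * d N = d N + S"
    using \<open>d N > 0\<close> by (simp add: y_def field_simps)
  ultimately show False
    using \<open>d N > 0\<close> by simp
qed

lemma L_const_sharp:
  assumes "\<mu> > -1" and "q > -1"
    and C: "\<And>x. x > 0 \<Longrightarrow>
      (\<integral>\<^sup>+t\<in>{0<..<x}. ennreal (t powr q * t powr (- \<mu>) * bessel_I \<mu> t) \<partial>lebesgue)
        \<ge> ennreal (C * x powr q * x powr (- \<mu>) * bessel_I (\<mu> + 1) x)"
  shows "C \<le> L_const \<mu> q"
proof -
  define b where "b = bessel_coeff (\<mu> + 1)"
  define c where "c = (\<lambda>k. bessel_coeff \<mu> k / (2 * real k + q + 1))"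
  define d where "d = (\<lambda>k. C * b k - c k)"
  have c_pos: "c k > 0" for k
    using assms bessel_coeff_pos[of \<mu> k] by (simp add: c_def)
  have summ_b: "summable (\<lambda>k. b k * y ^ k)" for y
    using assms by (simp add: b_def summable_bessel_coeff)
  have summ_c: "summable (\<lambda>k. c k * y ^ k)" for y
    unfolding c_def using assms(1,2) by (rule summable_bessel_coeff_integrated)
  have sums_d: "(\<lambda>k. d k * y ^ k) sums (C * (\<Sum>k. b k * y ^ k) - (\<Sum>k. c k * y ^ k))" for y
    using sums_diff[OF sums_mult[OF summable_sums[OF summ_b]] summable_sums[OF summ_c], of C y y]
    by (simp add: d_def algebra_simps)
  have d_le: "(\<Sum>k. d k * y ^ k) \<le> 0" if "y > 0" for y
  proof -
    define x where "x = sqrt y"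
    have x: "x > 0" "x\<^sup>2 = y"
      using that by (auto simp: x_def)
    \<comment> \<open>Needed to pass from \<open>ennreal\<close>, where negative numbers become \<open>0\<close>, back to the reals.\<close>
    have c_nonneg: "(\<Sum>k. c k * y ^ k) \<ge> 0"
      using c_pos that by (intro suminf_nonneg summ_c) (auto intro!: mult_nonneg_nonneg intro: less_imp_le)
    have "C * x powr q * x powr (- \<mu>) * bessel_I (\<mu> + 1) x
        = x powr (q + 1) * (C * (\<Sum>k. b k * y ^ k))"
      using x bessel_I_plus1_powser[OF assms(1) x(1)] by (simp add: b_def powr_add mult_ac)
    moreover have "(\<integral>\<^sup>+t\<in>{0<..<x}. ennreal (t powr q * t powr (- \<mu>) * bessel_I \<mu> t) \<partial>lebesgue)
        = ennreal (x powr (q + 1) * (\<Sum>k. c k * y ^ k))"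
      using nn_integral_powr_bessel_I[OF assms(1,2) x(1)] unfolding c_def x(2) .
    ultimately have "ennreal (x powr (q + 1) * (C * (\<Sum>k. b k * y ^ k)))
        \<le> ennreal (x powr (q + 1) * (\<Sum>k. c k * y ^ k))"
      using C[OF x(1)] by (simp only:)
    then have "x powr (q + 1) * (C * (\<Sum>k. b k * y ^ k)) \<le> x powr (q + 1) * (\<Sum>k. c k * y ^ k)"
      using c_nonneg by (subst (asm) ennreal_le_iff) auto
    then have "C * (\<Sum>k. b k * y ^ k) \<le> (\<Sum>k. c k * y ^ k)"
      using x(1) by simp
    then show ?thesis
      using sums_unique[OF sums_d, of y] by simp
  qed
  have summ_d: "summable (\<lambda>k. d k * y ^ k)" for y
    using sums_d by (rule sums_summable)
  have d_eq: "d k = bessel_coeff \<mu> k * (C / (2 * (real k + \<mu> + 1)) - 1 / (2 * real k + q + 1))" for k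
    unfolding d_def b_def c_def bessel_coeff_plus1[OF assms(1)] by (simp add: right_diff_distrib)
  have "d 0 \<le> 0"
    using powser_nonpos_imp_coeff_0_nonpos[of d] summ_d d_le by blast
  then have "C / (2 * (\<mu> + 1)) \<le> 1 / (q + 1)"
    using bessel_coeff_pos[OF assms(1), of 0] by (simp add: d_eq mult_le_0_iff)
  then have "C \<le> 2 * (\<mu> + 1) / (q + 1)"
    using assms by (simp add: field_simps)
  moreover have "C \<le> 1"
  proof (rule ccontr)
    assume "\<not> C \<le> 1"
    then have "C > 1" by simp
    obtain N :: nat where N: "real N > \<bar>2 * (\<mu> + 1) - C * (q + 1)\<bar> / (2 * (C - 1))"
      using reals_Archimedean2 by blast
    \<comment> \<open>\<open>d k > 0\<close> amounts to \<open>2 (\<mu> + 1) - C (q + 1) < 2 (C - 1) k\<close>.\<close>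
    have "d k > 0" if "k \<ge> N" for k
    proof -
      have "real k > \<bar>2 * (\<mu> + 1) - C * (q + 1)\<bar> / (2 * (C - 1))"
        using N that by linarith
      then have "\<bar>2 * (\<mu> + 1) - C * (q + 1)\<bar> < real k * (2 * (C - 1))"
        using \<open>C > 1\<close> by (subst (asm) divide_less_eq) auto
      then have "2 * (real k + \<mu> + 1) < C * (2 * real k + q + 1)"
        by (simp add: algebra_simps)
      then have "1 / (2 * real k + q + 1) < C / (2 * (real k + \<mu> + 1))"
        using assms by (simp add: field_simps)
      then show ?thesis
        using bessel_coeff_pos[OF assms(1), of k] by (simp add: d_eq)
    qed
    then have "eventually (\<lambda>k. d k > 0) sequentially"
      by (auto simp: eventually_sequentially)
    then show False
      using powser_nonpos_imp_not_eventually_pos[of d] summ_d d_le by blast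
  qed
  ultimately show ?thesis
    by (simp add: L_const_def)
qed

theorem theorem4p2:
  fixes \<mu> q :: real
  assumes "\<mu> > -1" and "q > -1"
  shows "(\<forall>\<gamma> w. 0 \<le> \<gamma> \<and> \<gamma> < 1 \<and> lower_power_weight q w \<longrightarrow>
            (\<forall>x>0. (\<integral>\<^sup>+t\<in>{0<..<x}. ennreal (exp (- \<gamma> * t) * w t * t powr (- \<mu>) * bessel_I \<mu> t) \<partial>lebesgue)
                 \<ge> ennreal (L_const \<mu> q * exp (- \<gamma> * x) * w x * x powr (- \<mu>) * bessel_I (\<mu> + 1) x)))
       \<and> (\<forall>C::real.
            (\<forall>x>0. (\<integral>\<^sup>+t\<in>{0<..<x}. ennreal (t powr q * t powr (- \<mu>) * bessel_I \<mu> t) \<partial>lebesgue)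
                 \<ge> ennreal (C * x powr q * x powr (- \<mu>) * bessel_I (\<mu> + 1) x))
            \<longrightarrow> C \<le> L_const \<mu> q)"
  using weighted_integral_ge[OF assms] L_const_sharp[OF assms] by blast

end
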